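(* Let $X$ be a real Hilbert space, $T:X\rightrightarrows X$ maximal monotone, $\sigma\ge 0$, $\underline\lambda>0$, and let $(\lambda_k)_{k\ge1}$ be a sequence in $[\underline\lambda,\infty)$. A sequence $(x_k)_{k\ge 0}$ in $X$ satisfies the recurrent inclusion $$x_k\in J_{\lambda_kT,\sigma}(x_{k-1}),\qquad k=1,2,\dots$$ if and only if there exist sequences $(y_k)_{k\ge1}$, $(v_k)_{k\ge1}$ in $X$ and $(\varepsilon_k)_{k\ge1}$ in $[0,\infty)$ such that, for $k=1,2,\dots$, $$v_k\in T^{[\varepsilon_k]}(y_k),\qquad \|\lambda_kv_k+y_k-x_{k-1}\|^2+2\lambda_k\varepsilon_k\le\sigma^2\|y_k-x_{k-1}\|^2,\qquad x_k=x_{k-1}-\lambda_kv_k$$ (that is, these sequences satisfy the steps of the Hybrid Proximal-Extragradient method).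
   Context: For maximal monotone $T:X\rightrightarrows X$ (point-to-set) and $\varepsilon\ge 0$, the $\varepsilon$-enlargement of $T$ is $$T^{[\varepsilon]}(x)=\{v\in X : \langle x-y,v-u\rangle\ge-\varepsilon\ \text{ for all } y\in X,\ u\in T(y)\}.$$ For $\sigma\ge 0$, the $\sigma$-approximate resolvent of $T$ is the point-to-set map $J_{T,\sigma}:X\rightrightarrows X$, $$J_{T,\sigma}(x)=\{x-v : \exists\,\varepsilon\ge 0,\ y\in X \text{ with } v\in T^{[\varepsilon]}(y),\ \|v+y-x\|^2+2\varepsilon\le\sigma^2\|y-x\|^2\}.$$ $J_{\lambda T,\sigma}$ denotes the $\sigma$-approximate resolvent of the maximal monotone operator $\lambda T$. *)

theory Defs
  imports "HOL-Analysis.Analysis"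
begin

text \<open>A point-to-set map on \<open>X\<close> is a function \<open>'a \<Rightarrow> 'a set\<close>; a value may be empty.
  A real Hilbert space is a type of sort \<open>{real_inner, complete_space}\<close>.\<close>

definition monotone_operator :: "('a::real_inner \<Rightarrow> 'a set) \<Rightarrow> bool" where
  "monotone_operator T \<longleftrightarrow>
     (\<forall>x y. \<forall>u\<in>T x. \<forall>v\<in>T y. (x - y) \<bullet> (u - v) \<ge> 0)"

text \<open>Maximality is with respect to inclusion of graphs, that is, pointwise inclusion of values.\<close>

definition maximal_monotone :: "('a::real_inner \<Rightarrow> 'a set) \<Rightarrow> bool" where
  "maximal_monotone T \<longleftrightarrow>
     monotone_operator T \<and>
     (\<forall>S. monotone_operator S \<and> (\<forall>x. T x \<subseteq> S x) \<longrightarrow> S = T)"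

definition scale_operator :: "real \<Rightarrow> ('a::real_inner \<Rightarrow> 'a set) \<Rightarrow> 'a \<Rightarrow> 'a set" where
  "scale_operator c T x = (\<lambda>u. c *\<^sub>R u) ` T x"

definition enlargement :: "('a::real_inner \<Rightarrow> 'a set) \<Rightarrow> real \<Rightarrow> 'a \<Rightarrow> 'a set" where
  "enlargement T \<epsilon> x = {v. \<forall>y. \<forall>u\<in>T y. (x - y) \<bullet> (v - u) \<ge> - \<epsilon>}"

definition approx_resolvent :: "('a::real_inner \<Rightarrow> 'a set) \<Rightarrow> real \<Rightarrow> 'a \<Rightarrow> 'a set" where
  "approx_resolvent T \<sigma> x =
     {x - v | v. \<exists>\<epsilon>\<ge>0. \<exists>y. v \<in> enlargement T \<epsilon> y \<and>
        (norm (v + y - x))\<^sup>2 + 2 * \<epsilon> \<le> \<sigma>\<^sup>2 * (norm (y - x))\<^sup>2}"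

end

theory Submission
  imports Defs
begin

text \<open>For \<open>c > 0\<close>, scaling the operator by \<open>c\<close> scales its \<open>\<epsilon>\<close>-enlargement to the \<open>c\<epsilon>\<close>-enlargement, so the witnesses of membership in
  the resolvent of \<open>cT\<close> are exactly \<open>cv\<close> and \<open>c\<epsilon>\<close> for witnesses \<open>v\<close> and \<open>\<epsilon>\<close> of the
  hybrid proximal-extragradient step.\<close>

lemma scaleR_mem_enlargement_scale_operator_iff:
  fixes T :: "'a::real_inner \<Rightarrow> 'a set"
  assumes "c > 0"
  shows "c *\<^sub>R v \<in> enlargement (scale_operator c T) (c * \<epsilon>) y \<longleftrightarrow> v \<in> enlargement T \<epsilon> y"
proof -
  \<comment> \<open>The elements of the scaled operator at \<open>z\<close> are exactly the
    \<open>c *\<^sub>R u\<close> with \<open>u\<close> in \<open>T z\<close>, so it suffices to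
    compare the two defining inequalities pair by pair; they differ by the positive factor
    \<open>c\<close>.\<close>
  have "- (c * \<epsilon>) \<le> (y - z) \<bullet> (c *\<^sub>R v - c *\<^sub>R u) \<longleftrightarrow> - \<epsilon> \<le> (y - z) \<bullet> (v - u)" for z u
  proof -
    have "(y - z) \<bullet> (c *\<^sub>R v - c *\<^sub>R u) = c * ((y - z) \<bullet> (v - u))"
      by (simp flip: scaleR_diff_right)
    moreover have "- (c * \<epsilon>) = c * (- \<epsilon>)"
      by simp
    ultimately show ?thesis
      using assms by (simp only: mult_le_cancel_left_pos)
  qed
  then show ?thesis
    by (simp add: enlargement_def scale_operator_def)
qed

text \<open>Isolates a single step of the method, so that the theorem only has to pick the witnesses
  for all steps simultaneously.\<close>

lemma mem_approx_resolvent_scale_operator_iff: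
  fixes T :: "'a::real_inner \<Rightarrow> 'a set"
  assumes c: "c > 0"
  shows "x' \<in> approx_resolvent (scale_operator c T) \<sigma> x \<longleftrightarrow>
    (\<exists>y v \<epsilon>. \<epsilon> \<ge> 0 \<and> v \<in> enlargement T \<epsilon> y \<and>
       (norm (c *\<^sub>R v + y - x))\<^sup>2 + 2 * c * \<epsilon> \<le> \<sigma>\<^sup>2 * (norm (y - x))\<^sup>2 \<and>
       x' = x - c *\<^sub>R v)"
    (is "?L \<longleftrightarrow> ?R")
proof
  assume ?L
  then obtain w \<delta> y where x': "x' = x - w" and \<delta>: "\<delta> \<ge> 0"
    and w: "w \<in> enlargement (scale_operator c T) \<delta> y"
    and le: "(norm (w + y - x))\<^sup>2 + 2 * \<delta> \<le> \<sigma>\<^sup>2 * (norm (y - x))\<^sup>2"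
    by (auto simp: approx_resolvent_def)
  define v \<epsilon> where "v = w /\<^sub>R c" and "\<epsilon> = \<delta> / c"
  then have w_eq: "w = c *\<^sub>R v" and \<delta>_eq: "\<delta> = c * \<epsilon>"
    using c by auto
  have "\<epsilon> \<ge> 0"
    using \<delta> c by (simp add: \<epsilon>_def)
  moreover have "v \<in> enlargement T \<epsilon> y"
    using w c by (simp add: w_eq \<delta>_eq scaleR_mem_enlargement_scale_operator_iff)
  ultimately show ?R
    using le x' by (auto simp: w_eq \<delta>_eq mult.assoc)
next
  assume ?R
  then obtain y v \<epsilon> where "\<epsilon> \<ge> 0" and "v \<in> enlargement T \<epsilon> y"
    \<comment> \<open>Reassociated so that \<open>c * \<epsilon>\<close> appears as the error in the
      definition of the resolvent, ready for \<open>blast\<close>.\<close>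
    and le: "(norm (c *\<^sub>R v + y - x))\<^sup>2 + 2 * (c * \<epsilon>) \<le> \<sigma>\<^sup>2 * (norm (y - x))\<^sup>2"
    and x': "x' = x - c *\<^sub>R v"
    by (auto simp: mult.assoc)
  then have "c * \<epsilon> \<ge> 0" and "c *\<^sub>R v \<in> enlargement (scale_operator c T) (c * \<epsilon>) y"
    using c by (simp_all add: scaleR_mem_enlargement_scale_operator_iff)
  with le x' show ?L
    unfolding approx_resolvent_def by blast
qed

theorem proposition4p4:
  fixes T :: "'a::{real_inner, complete_space} \<Rightarrow> 'a set"
    and \<sigma> lam_low :: real
    and lam :: "nat \<Rightarrow> real"
    and x :: "nat \<Rightarrow> 'a"
  assumes "maximal_monotone T"
    and "\<sigma> \<ge> 0"
    and "lam_low > 0"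
    and "\<forall>k\<ge>1. lam k \<in> {lam_low..}"
  shows "(\<forall>k\<ge>1. x k \<in> approx_resolvent (scale_operator (lam k) T) \<sigma> (x (k - 1))) \<longleftrightarrow>
    (\<exists>(y :: nat \<Rightarrow> 'a) (v :: nat \<Rightarrow> 'a) (\<epsilon> :: nat \<Rightarrow> real).
       \<forall>k\<ge>1. \<epsilon> k \<ge> 0 \<and>
         v k \<in> enlargement T (\<epsilon> k) (y k) \<and>
         (norm (lam k *\<^sub>R v k + y k - x (k - 1)))\<^sup>2 + 2 * lam k * \<epsilon> k
           \<le> \<sigma>\<^sup>2 * (norm (y k - x (k - 1)))\<^sup>2 \<and>
         x k = x (k - 1) - lam k *\<^sub>R v k)"
proof -
  have "lam k > 0" if "k \<ge> 1" for k
    using assms(3,4) that by force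
  \<comment> \<open>The guard \<open>k \<ge> 1\<close> moves inside the existentials, so that
    witnesses exist for every \<open>k\<close>; at \<open>k = 0\<close> they are arbitrary.\<close>
  then have "(\<forall>k\<ge>1. x k \<in> approx_resolvent (scale_operator (lam k) T) \<sigma> (x (k - 1))) \<longleftrightarrow>
    (\<forall>k. \<exists>y v \<epsilon>. k \<ge> 1 \<longrightarrow> \<epsilon> \<ge> 0 \<and> v \<in> enlargement T \<epsilon> y \<and>
       (norm (lam k *\<^sub>R v + y - x (k - 1)))\<^sup>2 + 2 * lam k * \<epsilon> \<le> \<sigma>\<^sup>2 * (norm (y - x (k - 1)))\<^sup>2 \<and>
       x k = x (k - 1) - lam k *\<^sub>R v)"
    by (simp add: mem_approx_resolvent_scale_operator_iff)
  then show ?thesis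
    \<comment> \<open>The axiom of choice, applied to \<open>y\<close>, \<open>v\<close> and
      \<open>\<epsilon>\<close> in turn, makes the stepwise witnesses into sequences.\<close>
    unfolding choice_iff .
qed

end
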